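(* Let $V$ be any vertex algebra. If $V$ is $C_2$-cofinite, i.e. $\dim V/C_2(V)<\infty$, then for every $n\ge 0$, $V$ is $E_n$-cofinite and $C_{n+2}$-cofinite, i.e. $\dim V/E_n(V)<\infty$ and $\dim V/C_{n+2}(V)<\infty$.
   Context: Vector spaces are over $\mathbb{C}$. For a vertex algebra $V$ write $Y(u,x)=\sum_{n\in\mathbb{Z}}u_nx^{-n-1}$. For $n\in\mathbb{Z}$, $E_n(V)$ is the linear span of the vectors $u^{(1)}_{-1-k_1}\cdots u^{(r)}_{-1-k_r}v$ for $r\ge 1$, $u^{(1)},\dots,u^{(r)},v\in V$, $k_1,\dots,k_r\ge 0$ with $k_1+\cdots+k_r\ge n$. For $n\ge 2$, $C_n(V)$ is the linear span of the vectors $u_{-n}v$ for $u,v\in V$. *)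

theory Defs
  imports Complex_Main "HOL-Library.Groups_Big_Fun"
begin

section \<open>Quotients of a complex vector space\<close>

locale complex_vector_space = vector_space scale
  for scale :: "complex \<Rightarrow> 'v::ab_group_add \<Rightarrow> 'v" (infixr \<open>*s\<close> 75)
begin

text \<open>The quotient of the whole space by a subspace \<open>W\<close> is the set of cosets of \<open>W\<close>, with zero
  vector \<open>W\<close>. Adding the elements of \<open>W\<close> in \<open>quotient_scale\<close> matters only for the scalar
  \<open>0\<close>, where scaling a coset elementwise would give \<open>{0}\<close> instead of \<open>W\<close>.\<close>

definition quotient_space :: "'v set \<Rightarrow> 'v set set"
  where "quotient_space W = range (\<lambda>v. (+) v ` W)"

definition quotient_add :: "'v set \<Rightarrow> 'v set \<Rightarrow> 'v set"
  where "quotient_add A B = {a + b | a b. a \<in> A \<and> b \<in> B}"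

definition quotient_scale :: "'v set \<Rightarrow> complex \<Rightarrow> 'v set \<Rightarrow> 'v set"
  where "quotient_scale W c A = {c *s a + w | a w. a \<in> A \<and> w \<in> W}"

definition quotient_subspace :: "'v set \<Rightarrow> 'v set set \<Rightarrow> bool"
  where "quotient_subspace W S \<longleftrightarrow> S \<subseteq> quotient_space W \<and> W \<in> S \<and>
    (\<forall>A\<in>S. \<forall>B\<in>S. quotient_add A B \<in> S) \<and> (\<forall>c. \<forall>A\<in>S. quotient_scale W c A \<in> S)"

text \<open>Finite dimensionality of the quotient by a subspace \<open>W\<close>: it is spanned by finitely many
  of its vectors. As for the library's \<open>span\<close>, the span is the subspace hull.\<close>

definition finite_dim_quotient :: "'v set \<Rightarrow> bool"
  where "finite_dim_quotient W \<longleftrightarrow>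
    (\<exists>B. finite B \<and> B \<subseteq> quotient_space W \<and> quotient_subspace W hull B = quotient_space W)"

lemma coset_add:
  assumes "subspace W"
  shows "quotient_add ((+) u ` W) ((+) v ` W) = (+) (u + v) ` W"
proof (intro equalityI subsetI)
  fix x assume "x \<in> quotient_add ((+) u ` W) ((+) v ` W)"
  then obtain a b where "a \<in> W" "b \<in> W" "x = (u + a) + (v + b)"
    unfolding quotient_add_def by blast
  then have "x = (u + v) + (a + b)" "a + b \<in> W"
    using assms by (auto simp: algebra_simps subspace_add)
  then show "x \<in> (+) (u + v) ` W" by blast
next
  fix x assume "x \<in> (+) (u + v) ` W"
  then obtain a where "a \<in> W" "x = (u + a) + (v + 0)" by (auto simp: algebra_simps)
  moreover have "0 \<in> W" using assms by (rule subspace_0)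
  ultimately show "x \<in> quotient_add ((+) u ` W) ((+) v ` W)"
    unfolding quotient_add_def by blast
qed

lemma coset_scale:
  assumes "subspace W"
  shows "quotient_scale W c ((+) v ` W) = (+) (c *s v) ` W"
proof (intro equalityI subsetI)
  fix x assume "x \<in> quotient_scale W c ((+) v ` W)"
  then obtain a w where "a \<in> W" "w \<in> W" "x = c *s (v + a) + w"
    unfolding quotient_scale_def by blast
  then have "x = c *s v + (c *s a + w)" "c *s a + w \<in> W"
    using assms by (auto simp: scale_right_distrib add.assoc subspace_add subspace_scale)
  then show "x \<in> (+) (c *s v) ` W" by blast
next
  fix x assume "x \<in> (+) (c *s v) ` W"
  then obtain w where "w \<in> W" "x = c *s (v + 0) + w" by auto
  moreover have "0 \<in> W" using assms by (rule subspace_0)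
  ultimately show "x \<in> quotient_scale W c ((+) v ` W)"
    unfolding quotient_scale_def by blast
qed

lemma coset_eq_iff:
  assumes "subspace W"
  shows "(+) u ` W = (+) v ` W \<longleftrightarrow> u - v \<in> W"
proof
  assume "(+) u ` W = (+) v ` W"
  moreover have "u + 0 \<in> (+) u ` W" using subspace_0[OF assms] by blast
  ultimately obtain w where "u + 0 = v + w" "w \<in> W" by blast
  then show "u - v \<in> W" by (simp add: algebra_simps)
next
  assume uv: "u - v \<in> W"
  have "(+) u ` W \<subseteq> (+) v ` W" if "u - v \<in> W" for u v
  proof
    fix x assume "x \<in> (+) u ` W"
    then obtain w where "w \<in> W" "x = v + ((u - v) + w)" by auto
    then show "x \<in> (+) v ` W" using that assms by (blast intro: subspace_add)
  qed
  moreover have "v - u \<in> W" using subspace_neg[OF assms uv] by simp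
  ultimately show "(+) u ` W = (+) v ` W" using uv by blast
qed

lemma quotient_span:
  assumes W: "subspace W"
  shows "quotient_subspace W hull ((\<lambda>v. (+) v ` W) ` B) = (\<lambda>v. (+) v ` W) ` span B"
    (is "_ = ?q ` _")
proof (rule hull_unique)
  show "?q ` B \<subseteq> ?q ` span B" by (intro image_mono span_superset)
  have "W = ?q 0" by simp
  then have "W \<in> ?q ` span B" using span_zero by (metis image_eqI)
  then show "quotient_subspace W (?q ` span B)"
    unfolding quotient_subspace_def quotient_space_def
    by (auto simp: coset_add[OF W] coset_scale[OF W] intro!: imageI span_add span_scale)
next
  fix S assume B: "?q ` B \<subseteq> S" and S: "quotient_subspace W S"
  have "?q x \<in> S" if "x \<in> span B" for x
    using that
  proof (induction rule: span_induct_alt)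
    case base
    then show ?case using S by (simp add: quotient_subspace_def)
  next
    case (step c x y)
    then have "quotient_add (quotient_scale W c (?q x)) (?q y) \<in> S"
      using S B unfolding quotient_subspace_def by blast
    then show ?case by (simp only: coset_add[OF W] coset_scale[OF W])
  qed
  then show "?q ` span B \<subseteq> S" by blast
qed

lemma finite_dim_quotient_iff:
  assumes W: "subspace W"
  shows "finite_dim_quotient W \<longleftrightarrow> (\<exists>B. finite B \<and> span (W \<union> B) = UNIV)"
proof -
  let ?q = "\<lambda>v. (+) v ` W"
  have *: "?q ` span B = quotient_space W \<longleftrightarrow> span (W \<union> B) = UNIV" for B
  proof -
    have "?q ` span B = quotient_space W \<longleftrightarrow> range ?q \<subseteq> ?q ` span B"
      unfolding quotient_space_def by (metis equalityE image_mono subset_UNIV subset_antisym)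
    also have "\<dots> \<longleftrightarrow> (\<forall>x. \<exists>y\<in>span B. ?q x = ?q y)"
      by (simp only: image_subset_iff image_iff UNIV_I ball_UNIV)
    also have "\<dots> \<longleftrightarrow> (\<forall>x. \<exists>y\<in>span B. x - y \<in> W)"
      by (simp only: coset_eq_iff[OF W])
    also have "\<dots> \<longleftrightarrow> (\<forall>x. x \<in> span (W \<union> B))"
    proof -
      have "(\<exists>y\<in>span B. x - y \<in> W) \<longleftrightarrow> x \<in> span (W \<union> B)" for x
      proof
        assume "\<exists>y\<in>span B. x - y \<in> W"
        then obtain y where y: "y \<in> span B" "x - y \<in> W" by blast
        have "x = (x - y) + y" by simp
        then show "x \<in> span (W \<union> B)"
          using y unfolding span_Un span_eq_iff[THEN iffD2, OF W] by blast
      next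
        assume "x \<in> span (W \<union> B)"
        then obtain a y where a: "x = a + y" "a \<in> W" "y \<in> span B"
          unfolding span_Un span_eq_iff[THEN iffD2, OF W] by blast
        then have "x - y \<in> W" by simp
        then show "\<exists>y\<in>span B. x - y \<in> W" using a(3) by blast
      qed
      then show ?thesis by blast
    qed
    finally show ?thesis by blast
  qed
  show ?thesis
  proof
    assume "finite_dim_quotient W"
    then obtain Q where Q: "finite Q" "Q \<subseteq> range ?q" "quotient_subspace W hull Q = quotient_space W"
      unfolding finite_dim_quotient_def quotient_space_def by metis
    obtain B where "finite B" "Q = ?q ` B" using finite_subset_image[OF Q(1,2)] by blast
    then show "\<exists>B. finite B \<and> span (W \<union> B) = UNIV"
      using Q(3) quotient_span[OF W] * by auto
  next
    assume "\<exists>B. finite B \<and> span (W \<union> B) = UNIV"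
    then obtain B where "finite B" "span (W \<union> B) = UNIV" by blast
    then have "quotient_subspace W hull (?q ` B) = quotient_space W"
      using quotient_span[OF W] * by simp
    moreover have "?q ` B \<subseteq> quotient_space W"
      unfolding quotient_space_def by (rule image_mono[OF subset_UNIV])
    ultimately show "finite_dim_quotient W"
      unfolding finite_dim_quotient_def using finite_imageI[OF \<open>finite B\<close>] by meson
  qed
qed

end


section \<open>Vertex algebras\<close>

text \<open>\<open>nprod u n v\<close> is \<open>u\<^sub>n v\<close>, the coefficient of \<open>x\<^bsup>-n-1\<^esup>\<close> in \<open>Y(u,x)v\<close>. The last axiom is the
  Jacobi identity
  \<open>x\<^sub>0\<^bsup>-1\<^esup> \<delta>((x\<^sub>1-x\<^sub>2)/x\<^sub>0) Y(u,x\<^sub>1)Y(v,x\<^sub>2) - x\<^sub>0\<^bsup>-1\<^esup> \<delta>((x\<^sub>2-x\<^sub>1)/(-x\<^sub>0)) Y(v,x\<^sub>2)Y(u,x\<^sub>1)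
    = x\<^sub>2\<^bsup>-1\<^esup> \<delta>((x\<^sub>1-x\<^sub>0)/x\<^sub>2) Y(Y(u,x\<^sub>0)v,x\<^sub>2)\<close>
  applied to \<open>w\<close>, read off at the coefficient of \<open>x\<^sub>0\<^bsup>-l-1\<^esup> x\<^sub>1\<^bsup>-m-1\<^esup> x\<^sub>2\<^bsup>-n-1\<^esup>\<close>. By \<open>truncation\<close> only
  finitely many terms of either sum are nonzero, so \<open>Sum_any\<close> is the actual sum.\<close>

locale vertex_algebra = complex_vector_space scale
  for scale :: "complex \<Rightarrow> 'v::ab_group_add \<Rightarrow> 'v" (infixr \<open>*s\<close> 75) +
  fixes nprod :: "'v \<Rightarrow> int \<Rightarrow> 'v \<Rightarrow> 'v"
    and vac :: 'v
  assumes nprod_linear_left: "Vector_Spaces.linear scale scale (\<lambda>u. nprod u n v)"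
    and nprod_linear_right: "Vector_Spaces.linear scale scale (\<lambda>v. nprod u n v)"
    and truncation: "\<exists>N. \<forall>n\<ge>N. nprod u n v = 0"
    and vacuum: "nprod vac n v = (if n = -1 then v else 0)"
    and creation_nonneg: "n \<ge> 0 \<Longrightarrow> nprod u n vac = 0"
    and creation: "nprod u (-1) vac = u"
    and jacobi:
      "Sum_any (\<lambda>i::nat. ((-1) ^ i * (of_int l gchoose i)) *s
          (nprod u (m + l - int i) (nprod v (n + int i) w)
            - ((-1) powi l) *s nprod v (n + l - int i) (nprod u (m + int i) w)))
       = Sum_any (\<lambda>i::nat. (of_int m gchoose i) *s nprod (nprod u (l + int i) v) (m + n - int i) w)"
begin

text \<open>The list \<open>[(u\<^sub>1, k\<^sub>1), \<dots>, (u\<^sub>r, k\<^sub>r)]\<close> encodes the operators applied to \<open>v\<close>, outermost first.\<close>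

definition E_space :: "int \<Rightarrow> 'v set"
  where "E_space n = span {foldr (\<lambda>(u, k) x. nprod u (-1 - int k) x) uks v | uks v.
    uks \<noteq> [] \<and> int (\<Sum>(u, k)\<leftarrow>uks. k) \<ge> n}"

definition C_space :: "int \<Rightarrow> 'v set"
  where "C_space n = span {nprod u (-n) v | u v. True}"

end

end

theory Submission
  imports Defs
begin

text \<open>Write \<open>E n\<close> and \<open>C n\<close> for the two families of subspaces. The commutator formula gives
  \<open>u\<^sub>j E s \<subseteq> E (s - j - 1)\<close>, and even \<open>u\<^sub>j E s \<subseteq> E (s - j)\<close> when \<open>j \<ge> 0\<close>. Consequently the
  operators \<open>u\<^bsub>-1-k\<^esub>\<close> with \<open>k \<ge> 0\<close> commute modulo higher filtration degree, and they raise the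
  degree by \<open>k + 1\<close> instead of \<open>k\<close> when \<open>u \<in> C 2\<close>. For \<open>n \<ge> 1\<close> a monomial of degree \<open>n\<close> can therefore
  be rewritten modulo \<open>E (n + 1)\<close> so that its outermost factor has \<open>k \<ge> 1\<close> and \<open>u\<close> in a finite
  complement of \<open>C 2\<close>; by induction \<open>E n\<close> is finite dimensional modulo \<open>E (n + 1)\<close>.

  The subspace \<open>C N\<close> is stable under all \<open>u\<^bsub>-p\<^esub>\<close> with \<open>p \<ge> 0\<close>, and the iterate formula for
  \<open>(u\<^bsub>-1\<^esub> a)\<^bsub>1-2N\<^esub> b\<close> gives \<open>u\<^bsub>-N\<^esub> C N \<subseteq> C (N + 1)\<close>. If \<open>E m \<subseteq> C N\<close>, a monomial of degree at least
  \<open>2 m + N\<close> either has a factor \<open>u\<^bsub>-1-k\<^esub>\<close> with \<open>k \<ge> N\<close> or splits into two monomials of degree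
  at least \<open>m\<close>; in both cases it lies in \<open>C (N + 1)\<close>. Hence every \<open>C N\<close> contains some \<open>E m\<close>.\<close>

section \<open>Preliminaries on lists and subspaces\<close>

text \<open>Cutting as soon as the running sum exceeds \<open>b\<close> overshoots by at most one
  entry, hence by at most \<open>c\<close>, and leaves at least \<open>a\<close>.\<close>

lemma sum_list_split_at:
  fixes f :: "'a \<Rightarrow> nat"
  assumes "sum_list (map f xs) \<ge> a + b + c" "\<And>x. x \<in> set xs \<Longrightarrow> f x \<le> c"
  obtains ys zs where "xs = ys @ zs" "sum_list (map f ys) \<ge> b" "sum_list (map f zs) \<ge> a"
proof -
  have "\<exists>ys zs. xs = ys @ zs \<and> sum_list (map f ys) \<ge> b \<and> sum_list (map f zs) \<ge> a"
    using assms
  proof (induction xs arbitrary: b)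
    case Nil
    then show ?case by simp
  next
    case (Cons x xs)
    show ?case
    proof (cases "f x \<le> b")
      case True
      with Cons.prems have "sum_list (map f xs) \<ge> a + (b - f x) + c" by simp
      from Cons.IH[OF this] Cons.prems(2) obtain ys zs where
        "xs = ys @ zs" "sum_list (map f ys) \<ge> b - f x" "sum_list (map f zs) \<ge> a" by auto
      then have "x # xs = (x # ys) @ zs \<and> sum_list (map f (x # ys)) \<ge> b \<and> sum_list (map f zs) \<ge> a"
        by simp
      then show ?thesis by blast
    next
      case False
      have "f x \<le> c" using Cons.prems(2) by simp
      with False Cons.prems(1)
      have "x # xs = [x] @ xs \<and> sum_list (map f [x]) \<ge> b \<and> sum_list (map f xs) \<ge> a"
        by simp
      then show ?thesis by blast
    qed
  qed
  then show thesis using that by blast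
qed

context complex_vector_space
begin

lemma Sum_any_mem:
  assumes "subspace W" "\<And>i. g i \<in> W"
  shows "Sum_any g \<in> W"
  unfolding Sum_any.expand_set using assms by (intro subspace_sum)

text \<open>Used to isolate one term of the iterate formula. With infinite support
  \<open>Sum_any g\<close> would be the default 0 and say nothing about the terms.\<close>

lemma Sum_any_term_mem:
  assumes W: "subspace W" and fin: "finite {i. g i \<noteq> 0}"
    and sum: "Sum_any g \<in> W" and others: "\<And>i. i \<noteq> j \<Longrightarrow> g i \<in> W"
  shows "g j \<in> W"
proof -
  have "Sum_any g = sum g (insert j {i. g i \<noteq> 0})"
    using fin by (intro Sum_any.expand_superset) auto
  also have "\<dots> = g j + sum g ({i. g i \<noteq> 0} - {j})"
    using fin by (rule sum.insert_remove)
  finally have "g j + sum g ({i. g i \<noteq> 0} - {j}) \<in> W" using sum by metis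
  moreover have "sum g ({i. g i \<noteq> 0} - {j}) \<in> W"
    using others by (intro subspace_sum W) auto
  ultimately have "g j + sum g ({i. g i \<noteq> 0} - {j}) - sum g ({i. g i \<noteq> 0} - {j}) \<in> W"
    by (rule subspace_diff[OF W])
  then show ?thesis by (simp only: add_diff_cancel_right')
qed

lemma mem_congI:
  assumes "subspace W" "x - y \<in> W" "y \<in> W"
  shows "x \<in> W"
  using subspace_add[OF assms] by simp

end

context vertex_algebra
begin

section \<open>Consequences of the Jacobi identity\<close>

lemma subspace_left: "subspace W \<Longrightarrow> subspace {u. nprod u n v \<in> W}"
  using module_hom.subspace_vimage[OF nprod_linear_left[folded module_hom_iff_linear], of W n v]
  by (simp add: vimage_def)

lemma subspace_right: "subspace W \<Longrightarrow> subspace {v. nprod u n v \<in> W}"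
  using module_hom.subspace_vimage[OF nprod_linear_right[folded module_hom_iff_linear], of W u n]
  by (simp add: vimage_def)

lemma nprod_zero_right [simp]: "nprod u n 0 = 0"
  using nprod_linear_right[folded module_hom_iff_linear] by (rule module_hom.zero)

text \<open>The Jacobi identity at \<open>l = 0\<close>: the coefficient \<open>0 gchoose i\<close>
  leaves only \<open>i = 0\<close> on the left.\<close>

lemma commutator_formula:
  "nprod u m (nprod v n w) - nprod v n (nprod u m w) =
    Sum_any (\<lambda>i::nat. (of_int m gchoose i) *s nprod (nprod u (int i) v) (m + n - int i) w)"
proof -
  let ?g = "\<lambda>i::nat. ((-1) ^ i * (of_int 0 gchoose i)) *s
          (nprod u (m + 0 - int i) (nprod v (n + int i) w)
            - ((-1) powi 0) *s nprod v (n + 0 - int i) (nprod u (m + int i) w))"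
  have "?g i = 0" if "i \<noteq> 0" for i
    using that by (cases i) (auto simp: gbinomial_0)
  then have "Sum_any ?g = sum ?g {0}"
    by (intro Sum_any.expand_superset) auto
  then show ?thesis using jacobi[of 0 u m v n w] by simp
qed

text \<open>The Jacobi identity at \<open>m = 0\<close>, where the right-hand sum collapses in the
  same way.\<close>

lemma iterate_formula:
  "nprod (nprod u l v) n w =
    Sum_any (\<lambda>i::nat. ((-1) ^ i * (of_int l gchoose i)) *s
          (nprod u (l - int i) (nprod v (n + int i) w)
            - ((-1) powi l) *s nprod v (n + l - int i) (nprod u (int i) w)))"
proof -
  let ?g = "\<lambda>i::nat. (of_int 0 gchoose i) *s nprod (nprod u (l + int i) v) (0 + n - int i) w"
  have "?g i = 0" if "i \<noteq> 0" for i
    using that by (cases i) (auto simp: gbinomial_0)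
  then have "Sum_any ?g = sum ?g {0}"
    by (intro Sum_any.expand_superset) auto
  then show ?thesis using jacobi[of l u 0 v n w] by simp
qed

lemma commutator_mem:
  assumes "subspace W" "\<And>i::nat. nprod (nprod u (int i) v) (m + n - int i) w \<in> W"
  shows "nprod u m (nprod v n w) - nprod v n (nprod u m w) \<in> W"
  unfolding commutator_formula using assms by (intro Sum_any_mem subspace_scale)

lemma iterate_mem:
  assumes "subspace W"
    and "\<And>i::nat. nprod u (l - int i) (nprod v (n + int i) w) \<in> W"
    and "\<And>i::nat. nprod v (n + l - int i) (nprod u (int i) w) \<in> W"
  shows "nprod (nprod u l v) n w \<in> W"
  unfolding iterate_formula using assms by (intro Sum_any_mem subspace_scale subspace_diff)

text \<open>Truncation annihilates both inner products, \<open>nprod v (n + int i) w\<close> and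
  \<open>nprod u (int i) w\<close>, once \<open>i\<close> is large.\<close>

lemma iterate_terms_finite:
  "finite {i::nat. ((-1) ^ i * (of_int l gchoose i)) *s
          (nprod u (l - int i) (nprod v (n + int i) w)
            - ((-1) powi l) *s nprod v (n + l - int i) (nprod u (int i) w)) \<noteq> 0}"
proof -
  obtain M where M: "\<And>k. k \<ge> M \<Longrightarrow> nprod u k w = 0" using truncation by blast
  obtain N where N: "\<And>k. k \<ge> N \<Longrightarrow> nprod v k w = 0" using truncation by blast
  show ?thesis
  proof (rule finite_subset)
    show "finite {..nat (max M (N - n))}" by simp
  qed (force simp: M N intro: ccontr)
qed


section \<open>The filtration \<open>E\<close>\<close>

abbreviation monomial :: "('v \<times> nat) list \<Rightarrow> 'v \<Rightarrow> 'v"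
  where "monomial \<equiv> foldr (\<lambda>(u, k) x. nprod u (-1 - int k) x)"

abbreviation weight :: "('v \<times> nat) list \<Rightarrow> nat"
  where "weight uks \<equiv> (\<Sum>(u, k)\<leftarrow>uks. k)"

lemma subspace_E [simp]: "subspace (E_space n)"
  unfolding E_space_def by (rule subspace_span)

text \<open>\<open>E_space\<close> asks for a nonempty list; prefixing the identity operator
  \<open>nprod vac (-1)\<close> covers the empty one.\<close>

lemma monomial_in_E:
  assumes "int (weight uks) \<ge> n"
  shows "monomial uks v \<in> E_space n"
proof -
  have "monomial ((vac, 0) # uks) v \<in> E_space n"
    unfolding E_space_def
  proof (intro span_base CollectI exI conjI)
    show "(vac, 0) # uks \<noteq> []" by simp
    show "n \<le> int (weight ((vac, 0) # uks))" using assms by simp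
  qed (rule refl)
  then show ?thesis by (simp add: vacuum)
qed

lemma E_subset:
  assumes "subspace W" "\<And>uks v. int (weight uks) \<ge> n \<Longrightarrow> monomial uks v \<in> W"
  shows "E_space n \<subseteq> W"
  unfolding E_space_def using assms by (intro span_minimal) auto

lemma E_antimono: "m \<le> n \<Longrightarrow> E_space n \<subseteq> E_space m"
  by (rule E_subset) (auto intro: monomial_in_E)

lemma E_nonpos: "n \<le> 0 \<Longrightarrow> E_space n = UNIV"
  using monomial_in_E[of n "[]"] by auto

lemma nprod_neg_E:
  assumes "x \<in> E_space s"
  shows "nprod u (-1 - int k) x \<in> E_space (s + int k)"
proof -
  have "E_space s \<subseteq> {x. nprod u (-1 - int k) x \<in> E_space (s + int k)}"
  proof (rule E_subset)
    fix uks v assume "int (weight uks) \<ge> s"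
    then show "monomial uks v \<in> {x. nprod u (-1 - int k) x \<in> E_space (s + int k)}"
      using monomial_in_E[of "s + int k" "(u, k) # uks" v] by simp
  qed (simp add: subspace_right)
  then show ?thesis using assms by blast
qed

lemma nprod_neg_E':
  assumes "x \<in> E_space s" "j < 0" "t \<le> s - j - 1"
  shows "nprod u j x \<in> E_space t"
  using nprod_neg_E[OF assms(1), of u "nat (-1 - j)"] E_antimono[OF assms(3)] assms(2)
  by (auto simp: algebra_simps)

text \<open>Move \<open>u\<close> inward. Commutator terms act on the shorter monomial with mode
  \<open>j = m - 1 - k - i\<close>: for \<open>j < 0\<close> the degree changes by
  \<open>k - m + i\<close>, for \<open>j \<ge> 0\<close> the induction hypothesis loses only
  \<open>j < m - k\<close>. These terms replace \<open>u\<close> by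
  \<open>nprod u (int i) a\<close>, so \<open>u\<close> and \<open>m\<close> must vary in the
  induction.\<close>

lemma nprod_nonneg_monomial:
  "0 \<le> m \<Longrightarrow> nprod u m (monomial uks v) \<in> E_space (int (weight uks) - m)"
proof (induction uks arbitrary: u m)
  case Nil
  then show ?case by (simp add: E_nonpos)
next
  case (Cons p uks)
  obtain a k where p: "p = (a, k)" by fastforce
  let ?x = "monomial uks v" and ?s = "int (weight uks)"
  let ?W = "E_space (?s + int k - m)"
  have "nprod u m (nprod a (-1 - int k) ?x) \<in> ?W"
  proof (rule mem_congI)
    show "nprod u m (nprod a (-1 - int k) ?x) - nprod a (-1 - int k) (nprod u m ?x) \<in> ?W"
    proof (rule commutator_mem)
      fix i :: nat
      let ?j = "m + (-1 - int k) - int i"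
      show "nprod (nprod u (int i) a) ?j ?x \<in> ?W"
      proof (cases "?j < 0")
        case True
        have "?x \<in> E_space ?s" by (simp add: monomial_in_E)
        then show ?thesis using True by (rule nprod_neg_E') simp
      next
        case False
        then have "nprod (nprod u (int i) a) ?j ?x \<in> E_space (?s - ?j)" by (intro Cons.IH) simp
        then show ?thesis using E_antimono[of "?s + int k - m" "?s - ?j"] by auto
      qed
    qed simp
    have "nprod u m ?x \<in> E_space (?s - m)" using Cons by blast
    then show "nprod a (-1 - int k) (nprod u m ?x) \<in> ?W"
      by (rule nprod_neg_E') auto
  qed simp
  moreover have "int (weight (p # uks)) - m = ?s + int k - m" by (simp add: p)
  moreover have "monomial (p # uks) v = nprod a (-1 - int k) ?x" by (simp add: p)
  ultimately show ?case by (simp only:)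
qed

lemma nprod_nonneg_E:
  assumes "x \<in> E_space s" "0 \<le> j" "t \<le> s - j"
  shows "nprod u j x \<in> E_space t"
proof -
  have "E_space s \<subseteq> {x. nprod u j x \<in> E_space t}"
  proof (rule E_subset)
    fix uks v assume "int (weight uks) \<ge> s"
    then show "monomial uks v \<in> {x. nprod u j x \<in> E_space t}"
      using nprod_nonneg_monomial[OF assms(2), of u uks v] assms(3)
        E_antimono[of t "int (weight uks) - j"] by auto
  qed (simp add: subspace_right)
  then show ?thesis using assms by blast
qed

text \<open>One bound for both signs of \<open>j\<close>: it gives away one degree when
  \<open>j \<ge> 0\<close> and saves the case split later.\<close>

lemma nprod_E:
  assumes "x \<in> E_space s" "t \<le> s - j - 1"
  shows "nprod u j x \<in> E_space t"
  using nprod_neg_E'[OF assms(1)] nprod_nonneg_E[OF assms(1)] assms(2)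
  by (cases "j < 0") auto

text \<open>The commutator terms have modes \<open>-2 - k - l - i\<close>, each raising the degree
  by at least \<open>k + l + 1\<close>.\<close>

lemma commutator_E:
  assumes "x \<in> E_space s"
  shows "nprod u (-1 - int k) (nprod v (-1 - int l) x) - nprod v (-1 - int l) (nprod u (-1 - int k) x)
    \<in> E_space (s + int k + int l + 1)"
  by (rule commutator_mem) (auto intro!: nprod_E[OF assms])


section \<open>Finiteness of the graded pieces\<close>

lemma subspace_C [simp]: "subspace (C_space n)"
  unfolding C_space_def by (rule subspace_span)

lemma C_base: "nprod u (-n) v \<in> C_space n"
  unfolding C_space_def by (rule span_base) blast

lemma C_subset:
  assumes "subspace W" "\<And>u v. nprod u (-n) v \<in> W"
  shows "C_space n \<subseteq> W"
  unfolding C_space_def using assms by (intro span_minimal) auto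

lemma C2_subset_E1: "C_space 2 \<subseteq> E_space 1"
  by (rule C_subset) (auto intro!: nprod_E[of _ 0] simp: E_nonpos)

text \<open>Expand \<open>u = nprod a (-2) b\<close> by the iterate formula. In the first kind of
  term \<open>b\<close> contributes at least \<open>k - i\<close> and \<open>a\<close> then
  \<open>1 + i\<close>; in the second \<open>a\<close> contributes at least \<open>-i\<close> and
  \<open>b\<close> then \<open>k + i + 2\<close>.\<close>

lemma C2_nprod_E:
  assumes "u \<in> C_space 2" and x: "x \<in> E_space s"
  shows "nprod u (-1 - int k) x \<in> E_space (s + int k + 1)"
proof -
  let ?W = "E_space (s + int k + 1)"
  have "C_space 2 \<subseteq> {u. nprod u (-1 - int k) x \<in> ?W}"
  proof (rule C_subset)
    fix a b
    have "nprod (nprod a (-2) b) (-1 - int k) x \<in> ?W"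
    proof (rule iterate_mem)
      fix i :: nat
      show "nprod a (-2 - int i) (nprod b (-1 - int k + int i) x) \<in> ?W"
        by (rule nprod_E, rule nprod_E[OF x, OF order_refl]) simp
      have "nprod a (int i) x \<in> E_space (s - int i)"
        by (rule nprod_nonneg_E[OF x]) auto
      then show "nprod b (-1 - int k + -2 - int i) (nprod a (int i) x) \<in> ?W"
        by (rule nprod_E) simp
    qed simp
    then show "nprod a (-2) b \<in> {u. nprod u (-1 - int k) x \<in> ?W}" by simp
  qed (simp add: subspace_left)
  then show ?thesis using assms by blast
qed

text \<open>Exposes an outermost factor that strictly raises the degree, so its argument lies in an
  earlier step and induction on \<open>n\<close> can be applied to it.\<close>

lemma E_subset_raising:
  assumes "n \<ge> 1"
  shows "E_space (int n) \<subseteq>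
    span (E_space (int n + 1) \<union> {nprod u (-1 - int k) x | u k x. k \<in> {1..n} \<and> x \<in> E_space (int (n - k))})"
    (is "_ \<subseteq> span (?E \<union> ?G)")
proof (rule E_subset)
  fix uks v assume "int (weight uks) \<ge> int n"
  then show "monomial uks v \<in> span (?E \<union> ?G)"
  proof (induction uks)
    case Nil
    then show ?case using assms by simp
  next
    case (Cons p uks)
    obtain a k where p: "p = (a, k)" by fastforce
    let ?x = "monomial uks v"
    consider "k = 0" | "1 \<le> k" "k \<le> n" | "n < k" by linarith
    then show ?case
    proof cases
      case 1
      \<comment> \<open>A factor with \<open>k = 0\<close> adds no weight. It suffices that the
        whole span is stable under it, as it commutes with the raising factors modulo
        \<open>E (n + 1)\<close>.\<close>
      have "span (?E \<union> ?G) \<subseteq> {x. nprod a (-1) x \<in> span (?E \<union> ?G)}"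
      proof (rule span_minimal; safe?)
        fix x assume "x \<in> ?E"
        then have "nprod a (-1) x \<in> ?E" by (rule nprod_E) simp
        then show "nprod a (-1) x \<in> span (?E \<union> ?G)" by (blast intro: span_base)
      next
        fix u l x assume l: "l \<in> {1..n}" and x: "x \<in> E_space (int (n - l))"
        show "nprod a (-1) (nprod u (-1 - int l) x) \<in> span (?E \<union> ?G)"
        proof (rule mem_congI)
          have "int (n - l) + int 0 + int l + 1 = int n + 1" using l by simp
          with commutator_E[OF x, of a 0 u l]
          show "nprod a (-1) (nprod u (-1 - int l) x) - nprod u (-1 - int l) (nprod a (-1) x)
              \<in> span (?E \<union> ?G)"
            by (auto intro: span_base)
          have "nprod a (-1) x \<in> E_space (int (n - l))" using x by (rule nprod_E) simp
          then show "nprod u (-1 - int l) (nprod a (-1) x) \<in> span (?E \<union> ?G)"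
            using l by (blast intro: span_base)
        qed (rule subspace_span)
      qed (rule subspace_right[OF subspace_span])
      moreover have "?x \<in> span (?E \<union> ?G)" using Cons 1 p by simp
      ultimately show ?thesis using 1 p by auto
    next
      case 2
      have "?x \<in> E_space (int (n - k))" using Cons.prems 2 p by (intro monomial_in_E) auto
      then have "nprod a (-1 - int k) ?x \<in> ?G" using 2 by force
      then show ?thesis using p by (auto intro: span_base)
    next
      case 3
      then have "monomial (p # uks) v \<in> ?E" using p by (intro monomial_in_E) auto
      then show ?thesis by (blast intro: span_base)
    qed
  qed
qed (rule subspace_span)

lemma E_finite_mod_next:
  assumes B: "finite B" "span (C_space 2 \<union> B) = UNIV"
  shows "\<exists>G. finite G \<and> E_space (int n) \<subseteq> span (E_space (int n + 1) \<union> G)"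
proof (induction n rule: less_induct)
  case (less n)
  show ?case
  proof (cases "n = 0")
    case True
    \<comment> \<open>In degree 0 the step \<open>E 0\<close> is the whole space, and
      \<open>B\<close> itself serves as \<open>G\<close>.\<close>
    have "span (C_space 2 \<union> B) \<subseteq> span (E_space 1 \<union> B)"
      using C2_subset_E1 by (intro span_mono) blast
    then show ?thesis using B True by auto
  next
    case False
    from less.IH obtain G where G: "\<And>j. j < n \<Longrightarrow> finite (G j)"
      "\<And>j. j < n \<Longrightarrow> E_space (int j) \<subseteq> span (E_space (int j + 1) \<union> G j)"
      by metis
    \<comment> \<open>In \<open>nprod u (-1 - int k) x\<close>, changing \<open>u\<close> by
      \<open>C 2\<close> or \<open>x\<close> by \<open>E (n - k + 1)\<close> alters the result only
      within \<open>E (n + 1)\<close>, so products of representatives suffice.\<close>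
    define H where "H = (\<Union>k\<in>{1..n}. \<Union>b\<in>B. nprod b (-1 - int k) ` G (n - k))"
    let ?S = "span (E_space (int n + 1) \<union> H)"
    have H: "finite H" unfolding H_def using B(1) G(1) False by auto
    have "nprod u (-1 - int k) x \<in> ?S" if k: "k \<in> {1..n}" and x: "x \<in> E_space (int (n - k))" for u k x
    proof -
      have "span (C_space 2 \<union> B) \<subseteq> {u. nprod u (-1 - int k) x \<in> ?S}"
      proof (rule span_minimal; safe?)
        fix u assume "u \<in> C_space 2"
        from C2_nprod_E[OF this x, of k] k show "nprod u (-1 - int k) x \<in> ?S"
          by (auto intro: span_base)
      next
        fix b assume b: "b \<in> B"
        have "span (E_space (int (n - k) + 1) \<union> G (n - k)) \<subseteq> {x. nprod b (-1 - int k) x \<in> ?S}"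
        proof (rule span_minimal; safe?)
          fix x assume "x \<in> E_space (int (n - k) + 1)"
          then have "nprod b (-1 - int k) x \<in> E_space (int n + 1)"
            by (rule nprod_E) (use k in auto)
          then show "nprod b (-1 - int k) x \<in> ?S" by (blast intro: span_base)
        next
          fix x assume "x \<in> G (n - k)"
          then have "nprod b (-1 - int k) x \<in> H" unfolding H_def using b k by blast
          then show "nprod b (-1 - int k) x \<in> ?S" by (blast intro: span_base)
        qed (rule subspace_right[OF subspace_span])
        then show "nprod b (-1 - int k) x \<in> ?S" using G(2)[of "n - k"] x k by auto
      qed (rule subspace_left[OF subspace_span])
      then show ?thesis using B(2) by blast
    qed
    then have "span (E_space (int n + 1) \<union>
        {nprod u (-1 - int k) x | u k x. k \<in> {1..n} \<and> x \<in> E_space (int (n - k))}) \<subseteq> ?S"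
      by (intro span_minimal subspace_span) (auto intro: span_base)
    then show ?thesis using E_subset_raising[of n] False H by fastforce
  qed
qed

text \<open>Collects the finitely many vectors needed at each step of the filtration, starting from
  \<open>E 0 = UNIV\<close>.\<close>

lemma E_cofinite:
  assumes "finite_dim_quotient (C_space 2)"
  shows "finite_dim_quotient (E_space (int n))"
proof -
  obtain B where B: "finite B" "span (C_space 2 \<union> B) = UNIV"
    using assms finite_dim_quotient_iff by auto
  have "\<exists>F. finite F \<and> span (E_space (int n) \<union> F) = UNIV"
  proof (induction n)
    case 0
    then show ?case using E_nonpos[of 0] by (intro exI[of _ "{}"]) simp
  next
    case (Suc n)
    then obtain F where F: "finite F" "span (E_space (int n) \<union> F) = UNIV" by blast
    obtain G where G: "finite G" "E_space (int n) \<subseteq> span (E_space (int n + 1) \<union> G)"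
      using E_finite_mod_next[OF B] by blast
    let ?S = "span (E_space (int n + 1) \<union> (G \<union> F))"
    have "span (E_space (int n + 1) \<union> G) \<subseteq> ?S" by (rule span_mono) blast
    then have "span (E_space (int n) \<union> F) \<subseteq> ?S"
      using G(2) by (intro span_minimal subspace_span) (auto intro: span_base)
    then show ?case using F G(1) by (intro exI[of _ "G \<union> F"]) (auto simp: add.commute)
  qed
  then show ?thesis using finite_dim_quotient_iff by simp
qed


section \<open>Comparing \<open>E\<close> and \<open>C\<close>\<close>

text \<open>The iterate formula for \<open>(u\<^bsub>-2\<^esub> \<one>)\<^bsub>-n\<^esub> v\<close> has the single term \<open>n u\<^bsub>-n-1\<^esub> v\<close>.\<close>

lemma nprod_Suc_in_C:
  assumes "n \<ge> 1"
  shows "nprod u (-1 - int n) v \<in> C_space (int n)"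
proof -
  let ?c = "\<lambda>i::nat. (-1) ^ i * (of_int (-2) gchoose i) :: complex"
  let ?g = "\<lambda>i::nat. ?c i *s
          (nprod u (-2 - int i) (nprod vac (-int n + int i) v)
            - ((-1) powi (-2)) *s nprod vac (-int n + -2 - int i) (nprod u (int i) v))"
  \<comment> \<open>Only mode \<open>-1\<close> of \<open>vac\<close> is nonzero:
    \<open>-n + i = -1\<close> forces \<open>i = n - 1\<close>, and \<open>-n - 2 - i\<close> is
    never \<open>-1\<close>.\<close>
  have "?g (n - 1) \<in> C_space (int n)"
  proof (rule Sum_any_term_mem[where g = ?g])
    show "finite {i. ?g i \<noteq> 0}" by (rule iterate_terms_finite)
    show "Sum_any ?g \<in> C_space (int n)"
      unfolding iterate_formula[symmetric] by (rule C_base)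
    show "?g i \<in> C_space (int n)" if "i \<noteq> n - 1" for i
      using that assms by (auto simp: vacuum intro: subspace_0)
  qed simp
  moreover have "-2 - int (n - 1) = -1 - int n" "-int n + int (n - 1) = -1"
    using assms by auto
  ultimately have "?c (n - 1) *s nprod u (-1 - int n) v \<in> C_space (int n)"
    by (simp add: vacuum)
  moreover have "?c (n - 1) = of_nat n"
  proof -
    have "((-2 :: complex) gchoose (n - 1)) = (-1) ^ (n - 1) * (of_nat n gchoose (n - 1))"
      using gbinomial_minus[of "2 :: complex" "n - 1"] assms by (simp add: of_nat_diff)
    also have "(of_nat n gchoose (n - 1) :: complex) = of_nat n"
      using assms binomial_symmetric[of 1 n]
      by (simp flip: binomial_gbinomial)
    finally show ?thesis by (simp flip: power_mult_distrib mult.assoc)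
  qed
  ultimately have "of_nat n *s nprod u (-1 - int n) v \<in> C_space (int n)" by simp
  then have "(1 / of_nat n) *s (of_nat n *s nprod u (-1 - int n) v) \<in> C_space (int n)"
    by (rule subspace_scale[OF subspace_C])
  then show ?thesis using assms by simp
qed

lemma C_antimono:
  assumes "1 \<le> m" "m \<le> n"
  shows "C_space (int n) \<subseteq> C_space (int m)"
  using assms(2)
proof (induction n rule: dec_induct)
  case (step n)
  have "C_space (int (Suc n)) \<subseteq> C_space (int n)"
  proof (rule C_subset)
    fix u v
    have "- int (Suc n) = -1 - int n" by simp
    moreover have "1 \<le> n" using assms(1) step.hyps(1) by simp
    ultimately show "nprod u (- int (Suc n)) v \<in> C_space (int n)"
      using nprod_Suc_in_C[of n u v] by (simp only:)
  qed simp
  with step show ?case by blast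
qed simp

lemma nprod_in_C:
  assumes "1 \<le> N" "j \<le> - int N"
  shows "nprod u j v \<in> C_space (int N)"
proof -
  have "nprod u j v \<in> C_space (int (nat (-j)))"
    using C_base[of u "-j" v] assms by simp
  moreover have "N \<le> nat (-j)" using assms by linarith
  ultimately show ?thesis using C_antimono[OF assms(1)] by blast
qed

text \<open>Commuting \<open>u\<close> past \<open>nprod a (- int N)\<close> leaves terms of mode
  \<open>j - N - i\<close>, which is at most \<open>-N\<close>.\<close>

lemma nprod_C:
  assumes "1 \<le> N" "j \<le> 0" "x \<in> C_space (int N)"
  shows "nprod u j x \<in> C_space (int N)"
proof -
  have "C_space (int N) \<subseteq> {x. nprod u j x \<in> C_space (int N)}"
  proof (rule C_subset)
    fix a b
    have "nprod u j (nprod a (- int N) b) \<in> C_space (int N)"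
    proof (rule mem_congI)
      show "nprod u j (nprod a (- int N) b) - nprod a (- int N) (nprod u j b) \<in> C_space (int N)"
        using assms by (intro commutator_mem nprod_in_C) auto
    qed (simp_all add: C_base)
    then show "nprod a (- int N) b \<in> {x. nprod u j x \<in> C_space (int N)}" by simp
  qed (simp add: subspace_right)
  then show ?thesis using assms by blast
qed

text \<open>The mode \<open>1 - 2 * N\<close> makes the term \<open>i = N - 1\<close> exactly the
  wanted product; \<open>N \<ge> 2\<close> gives \<open>1 - 2 * N \<le> -N - 1\<close>, putting the
  left side in \<open>C (N + 1)\<close>.\<close>

lemma nprod_C_Suc:
  assumes N: "2 \<le> N" and "x \<in> C_space (int N)"
  shows "nprod u (- int N) x \<in> C_space (int (Suc N))"
proof -
  have "C_space (int N) \<subseteq> {x. nprod u (- int N) x \<in> C_space (int (Suc N))}"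
  proof (rule C_subset)
    fix a b
    let ?W = "C_space (int (Suc N))" and ?n = "1 - 2 * int N"
    let ?g = "\<lambda>i::nat. ((-1) ^ i * (of_int (-1) gchoose i)) *s
          (nprod u (-1 - int i) (nprod a (?n + int i) b)
            - ((-1) powi (-1)) *s nprod a (?n + -1 - int i) (nprod u (int i) b))"
    have second: "nprod a (?n + -1 - int i) (nprod u (int i) b) \<in> ?W" for i
      using N by (intro nprod_in_C) auto
    have "?g (N - 1) \<in> ?W"
    proof (rule Sum_any_term_mem[where g = ?g])
      show "finite {i. ?g i \<noteq> 0}" by (rule iterate_terms_finite)
      show "Sum_any ?g \<in> ?W"
        unfolding iterate_formula[symmetric] using N by (intro nprod_in_C) auto
      show "?g i \<in> ?W" if "i \<noteq> N - 1" for i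
      proof -
        \<comment> \<open>On either side of \<open>N - 1\<close> one mode is at most
          \<open>-N - 1\<close>: the inner one for smaller \<open>i\<close>, where the outer mode
          preserves \<open>C (N + 1)\<close>, and the outer one for larger \<open>i\<close>.\<close>
        have "nprod u (-1 - int i) (nprod a (?n + int i) b) \<in> ?W"
        proof (cases "i < N - 1")
          case True
          then show ?thesis using N by (intro nprod_C nprod_in_C) auto
        next
          case False
          then show ?thesis using N that by (intro nprod_in_C) auto
        qed
        then show ?thesis using second by (intro subspace_scale subspace_diff subspace_C)
      qed
    qed simp
    moreover have "(-1) ^ (N - 1) * (of_int (-1) gchoose (N - 1)) = (1 :: complex)"
    proof -
      have "(-1 :: complex) gchoose k = (-1) ^ k" for k
        using gbinomial_minus[of "1 :: complex" k] by (simp flip: binomial_gbinomial)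
      then show ?thesis by (simp flip: power_mult_distrib)
    qed
    ultimately have "nprod u (-1 - int (N - 1)) (nprod a (?n + int (N - 1)) b)
        - ((-1) powi (-1)) *s nprod a (?n + -1 - int (N - 1)) (nprod u (int (N - 1)) b) \<in> ?W"
      by simp
    from this subspace_scale[OF subspace_C second]
    have "nprod u (-1 - int (N - 1)) (nprod a (?n + int (N - 1)) b) \<in> ?W"
      by (rule mem_congI[OF subspace_C])
    moreover have "-1 - int (N - 1) = - int N" "?n + int (N - 1) = - int N" using N by auto
    ultimately show "nprod a (- int N) b \<in> {x. nprod u (- int N) x \<in> ?W}" by simp
  qed (simp add: subspace_right)
  then show ?thesis using assms by blast
qed

section \<open>Monomials acting on \<open>C N\<close>, and the inclusion of some \<open>E m\<close>
  in each \<open>C N\<close>\<close>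

lemma monomial_C:
  assumes "1 \<le> N" "x \<in> C_space (int N)"
  shows "monomial uks x \<in> C_space (int N)"
  using assms by (induction uks) (auto intro: nprod_C)

lemma monomial_in_C:
  assumes "1 \<le> N" "(u, k) \<in> set uks" "N \<le> Suc k"
  shows "monomial uks v \<in> C_space (int N)"
proof -
  obtain xs ys where "uks = xs @ (u, k) # ys" using assms(2) by (meson split_list)
  moreover have "nprod u (-1 - int k) (monomial ys v) \<in> C_space (int N)"
    using assms by (intro nprod_in_C) auto
  ultimately show ?thesis using monomial_C[OF assms(1)] by simp
qed

text \<open>Each exchange produces modes \<open>-1 - k - N - i\<close>, at most
  \<open>-N - 1\<close>, and the remaining outer factors preserve \<open>C (N + 1)\<close>.\<close>

lemma monomial_commutes_mod_C:
  assumes "1 \<le> N"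
  shows "monomial uks (nprod a (- int N) b) - nprod a (- int N) (monomial uks b)
    \<in> C_space (int (Suc N))" (is "_ \<in> ?W")
proof (induction uks)
  case Nil
  then show ?case by (simp add: subspace_0)
next
  case (Cons p uks)
  obtain u k where p: "p = (u, k)" by fastforce
  let ?j = "-1 - int k"
  let ?x = "monomial uks (nprod a (- int N) b)" and ?y = "nprod a (- int N) (monomial uks b)"
  have "nprod u ?j (?x - ?y) \<in> ?W"
    using Cons by (intro nprod_C) auto
  then have "nprod u ?j ?x - nprod u ?j ?y \<in> ?W"
    by (simp add: module_hom.diff[OF nprod_linear_right[folded module_hom_iff_linear]])
  moreover have "nprod u ?j ?y - nprod a (- int N) (nprod u ?j (monomial uks b)) \<in> ?W"
    using assms by (intro commutator_mem nprod_in_C) auto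
  ultimately have "(nprod u ?j ?x - nprod u ?j ?y)
      + (nprod u ?j ?y - nprod a (- int N) (nprod u ?j (monomial uks b))) \<in> ?W"
    by (rule subspace_add[OF subspace_C])
  then show ?case by (simp add: p)
qed

lemma E_subset_C_step:
  assumes N: "2 \<le> N" and m: "E_space (int m) \<subseteq> C_space (int N)"
  shows "E_space (int (m + m + N)) \<subseteq> C_space (int (Suc N))"
proof (rule E_subset)
  fix uks v assume weight: "int (weight uks) \<ge> int (m + m + N)"
  show "monomial uks v \<in> C_space (int (Suc N))"
  proof (cases "\<exists>p\<in>set uks. snd p \<ge> N")
    case True
    then obtain u k where "(u, k) \<in> set uks" "Suc N \<le> Suc k" by auto
    then show ?thesis by (intro monomial_in_C) auto
  next
    case False
    \<comment> \<open>Each part needs weight \<open>m\<close>; the extra \<open>N\<close> pays for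
      the factor at the cut.\<close>
    with weight obtain xs ys where split: "uks = xs @ ys" "weight xs \<ge> m" "weight ys \<ge> m"
      by (elim sum_list_split_at[of m m N "\<lambda>(u, k). k" uks, rotated 2]) auto
    \<comment> \<open>The inner part yields an element of \<open>C N\<close>. On a spanning vector
      \<open>nprod a (- int N) b\<close>, pull this mode outside \<open>xs\<close>; then
      \<open>monomial xs b\<close> lies in \<open>C N\<close> again and \<open>nprod_C_Suc\<close>
      applies.\<close>
    have "C_space (int N) \<subseteq> {x. monomial xs x \<in> C_space (int (Suc N))}"
    proof (rule C_subset)
      fix a b
      have "monomial xs (nprod a (- int N) b) \<in> C_space (int (Suc N))"
      proof (rule mem_congI)
        show "monomial xs (nprod a (- int N) b) - nprod a (- int N) (monomial xs b)
          \<in> C_space (int (Suc N))"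
          using N by (intro monomial_commutes_mod_C) simp
        have "monomial xs b \<in> C_space (int N)"
          using m monomial_in_E[of "int m" xs b] split by auto
        then show "nprod a (- int N) (monomial xs b) \<in> C_space (int (Suc N))"
          using N by (intro nprod_C_Suc)
      qed simp
      then show "nprod a (- int N) b \<in> {x. monomial xs x \<in> C_space (int (Suc N))}" by simp
    next
      show "subspace {x. monomial xs x \<in> C_space (int (Suc N))}"
      \<comment> \<open>Appending an innermost factor takes the preimage, under that one operator,
        of the subspace already obtained.\<close>
      proof (induction xs rule: rev_induct)
        case (snoc p xs)
        then show ?case using subspace_right by (cases p) fastforce
      qed simp
    qed
    moreover have "monomial ys v \<in> C_space (int N)"
      using m monomial_in_E[of "int m" ys v] split by auto
    ultimately show ?thesis using split(1) by auto
  qed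
qed simp

text \<open>For \<open>C 2\<close> the choice \<open>m = 1\<close> works, since positive weight
  forces a factor with \<open>k \<ge> 1\<close>; each further step replaces \<open>m\<close> by
  \<open>2 * m + n + 2\<close>.\<close>

lemma E_subset_C: "\<exists>m. E_space (int m) \<subseteq> C_space (int (n + 2))"
proof (induction n)
  case 0
  have "E_space (int 1) \<subseteq> C_space (int 2)"
  proof (rule E_subset)
    fix uks v assume "int (weight uks) \<ge> int 1"
    moreover have "weight uks = 0" if "\<forall>p\<in>set uks. snd p = 0"
      using that by (induction uks) auto
    ultimately obtain u k where "(u, k) \<in> set uks" "2 \<le> Suc k" by fastforce
    then show "monomial uks v \<in> C_space (int 2)" by (intro monomial_in_C) auto
  qed simp
  then show ?case by (metis add_0)
next
  case (Suc n)
  then obtain m where "E_space (int m) \<subseteq> C_space (int (n + 2))" by blast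
  then have "E_space (int (m + m + (n + 2))) \<subseteq> C_space (int (Suc (n + 2)))"
    by (rule E_subset_C_step[rotated]) simp
  then show ?case unfolding add_Suc by (rule exI)
qed

lemma C_cofinite:
  assumes "finite_dim_quotient (C_space 2)"
  shows "finite_dim_quotient (C_space (int (n + 2)))"
proof -
  obtain m where m: "E_space (int m) \<subseteq> C_space (int (n + 2))" using E_subset_C by blast
  obtain B where B: "finite B" "span (E_space (int m) \<union> B) = UNIV"
    using E_cofinite[OF assms, of m] finite_dim_quotient_iff[OF subspace_E] by auto
  have "span (E_space (int m) \<union> B) \<subseteq> span (C_space (int (n + 2)) \<union> B)"
    using m by (intro span_mono) blast
  then show ?thesis using B finite_dim_quotient_iff[OF subspace_C] by auto
qed

end

theorem proposition4p4:
  fixes scale :: "complex \<Rightarrow> 'v::ab_group_add \<Rightarrow> 'v"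
    and nprod :: "'v \<Rightarrow> int \<Rightarrow> 'v \<Rightarrow> 'v"
    and vac :: 'v
  assumes "vertex_algebra scale nprod vac"
    and "complex_vector_space.finite_dim_quotient scale (vertex_algebra.C_space scale nprod 2)"
  shows "\<forall>n\<ge>0. complex_vector_space.finite_dim_quotient scale (vertex_algebra.E_space scale nprod n) \<and>
    complex_vector_space.finite_dim_quotient scale (vertex_algebra.C_space scale nprod (n + 2))"
proof (intro allI impI)
  interpret vertex_algebra scale nprod vac by (rule assms(1))
  fix n :: int assume "n \<ge> 0"
  then show "finite_dim_quotient (E_space n) \<and> finite_dim_quotient (C_space (n + 2))"
    using E_cofinite[OF assms(2), of "nat n"] C_cofinite[OF assms(2), of "nat n"]
    by (simp add: add.commute)
qed

end
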